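(* (Completeness.) Let $\mathbf{L}$ be a complete residuated lattice, $F$ a type, $X$ a set of variables with $T_F(X)\neq\emptyset$. For every $\mathbf{L}$-set $\Sigma\colon T_F(X)\times T_F(X)\to L$ and all $t,t'\in T_F(X)$, $$|t\preccurlyeq t'|_{\Sigma}=\|t\preccurlyeq t'\|_{\Sigma},$$ i.e. the degree of provability of $t\preccurlyeq t'$ from $\Sigma$ equals the degree to which $t\preccurlyeq t'$ semantically follows from $\Sigma$.
   Context: A complete residuated lattice is $\mathbf{L}=\langle L,\wedge,\vee,\otimes,\rightarrow,0,1\rangle$ where $\langle L,\wedge,\vee,0,1\rangle$ is a complete lattice, $\langle L,\otimes,1\rangle$ is a commutative monoid, and $a\otimes b\le c$ iff $a\le b\rightarrow c$. A type $F$ is a set of function symbols with finite arities; $T_F(X)$ is the set of terms over $F$ and variables $X$. Formulas (inequalities) $t\preccurlyeq t'$ are identified with pairs in $T_F(X)\times T_F(X)$; $\Sigma$ assigns to each inequality a degree in $L$. Semantics. An algebra with $\mathbf{L}$-order of type $F$ is $\mathbf{M}=\langle M,\preccurlyeq^{\mathbf{M}},F^{\mathbf{M}}\rangle$ where $\langle M,F^{\mathbf{M}}\rangle$ is an algebra of type $F$ and $\preccurlyeq^{\mathbf{M}}\colon M\times M\to L$ satisfies: (i) $a\preccurlyeq^{\mathbf{M}} b=b\preccurlyeq^{\mathbf{M}} a=1$ iff $a=b$; (ii) $(a\preccurlyeq^{\mathbf{M}} b)\otimes(b\preccurlyeq^{\mathbf{M}} c)\le a\preccurlyeq^{\mathbf{M}}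 c$; (iii) $(a_1\preccurlyeq^{\mathbf{M}} b_1)\otimes\cdots\otimes(a_n\preccurlyeq^{\mathbf{M}} b_n)\le f^{\mathbf{M}}(a_1,\dots,a_n)\preccurlyeq^{\mathbf{M}} f^{\mathbf{M}}(b_1,\dots,b_n)$ for every $n$-ary $f\in F$. For $v\colon X\to M$, $\|t\|_{\mathbf{M},v}$ is the value of $t$ under $v$; $\|t\preccurlyeq t'\|_{\mathbf{M}}=\bigwedge_{v\colon X\to M}\big(\|t\|_{\mathbf{M},v}\preccurlyeq^{\mathbf{M}}\|t'\|_{\mathbf{M},v}\big)$. $\mathbf{M}$ is a model of $\Sigma$ if $\Sigma(t,t')\le\|t\preccurlyeq t'\|_{\mathbf{M}}$ for all $t,t'$, and $\|t\preccurlyeq t'\|_{\Sigma}=\bigwedge\{\|t\preccurlyeq t'\|_{\mathbf{M}}:\mathbf{M}\text{ a model of }\Sigma\}$. Syntax. Axioms: the $\mathbf{L}$-set $A$ with $A(t,t')=1$ if $t=t'$ and $0$ otherwise. Deduction rules (on pairs $\langle\varphi,a\rangle$ of a formula and a degree): Transitivity: from $\langle t\preccurlyeq t',a\rangle,\langle t'\preccurlyeq t'',b\rangle$ infer $\langle t\preccurlyeq t'',a\otimes b\rangle$; Compatibility (one rule for each $n$-ary $f\in F$): from $\langle t_1\preccurlyeq t_1',a_1\rangle,\dots,\langle t_n\preccurlyeq t_n',a_n\rangle$ infer $\langle f(t_1,\dots,t_n)\preccurlyeq f(t_1',\dots,t_n'),a_1\otimes\cdots\otimes a_n\rangle$; Invariance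 (one rule for each homomorphism $h\colon T_F(X)\to T_F(X)$ of the term algebra, i.e. each simultaneous substitution of terms for variables): from $\langle t\preccurlyeq t',a\rangle$ infer $\langle h(t)\preccurlyeq h(t'),a\rangle$. A proof of $\langle\varphi,a\rangle$ from $\Sigma$ is a finite sequence $\langle\varphi_1,a_1\rangle,\dots,\langle\varphi_n,a_n\rangle$ with $\langle\varphi_n,a_n\rangle=\langle\varphi,a\rangle$ such that each $a_i=\Sigma(\varphi_i)$, or $a_i=A(\varphi_i)$, or $\langle\varphi_i,a_i\rangle$ results from earlier members by one of the deduction rules. The provability degree is $|\varphi|_{\Sigma}=\bigvee\{a\in L:\text{there is a proof of }\langle\varphi,a\rangle\text{ from }\Sigma\}$. *)

theory Defs
  imports Main "HOL-Library.FuncSet"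
begin

text \<open>The bounds 0 and 1 of the lattice are \<^const>\<open>bot\<close> and \<^const>\<open>top\<close>; the latter is required
  to be the unit of the monoid, and the product is \<open>*\<close>.\<close>

class complete_residuated_lattice = complete_lattice + comm_monoid_mult +
  fixes residuum :: "'a \<Rightarrow> 'a \<Rightarrow> 'a"
  assumes one_eq_top: "1 = top"
    and adjointness: "a * b \<le> c \<longleftrightarrow> a \<le> residuum b c"

datatype ('f, 'x) trm = Var 'x | Fun 'f "('f, 'x) trm list"

type_synonym ('f, 'x) ineq = "('f, 'x) trm \<times> ('f, 'x) trm"

text \<open>A type \<open>F :: 'f \<rightharpoonup> nat\<close> maps each of its function symbols to its arity; both \<open>F\<close> and the set
  \<open>X\<close> of variables may be empty.\<close>

inductive_set terms :: "('f \<rightharpoonup> nat) \<Rightarrow> 'x set \<Rightarrow> ('f, 'x) trm set"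
  for F :: "'f \<rightharpoonup> nat" and X :: "'x set"
  where
    Var: "x \<in> X \<Longrightarrow> Var x \<in> terms F X"
  | Fun: "F f = Some (length ts) \<Longrightarrow> (\<forall>t\<in>set ts. t \<in> terms F X) \<Longrightarrow> Fun f ts \<in> terms F X"

record ('f, 'm, 'l) lalgebra =
  univ :: "'m set"
  lord :: "'m \<Rightarrow> 'm \<Rightarrow> 'l"
  opn :: "'f \<Rightarrow> 'm list \<Rightarrow> 'm"

definition algebra_with_lorder ::
  "('f \<rightharpoonup> nat) \<Rightarrow> ('f, 'm, 'l::complete_residuated_lattice) lalgebra \<Rightarrow> bool"
  where "algebra_with_lorder F M \<longleftrightarrow>
    univ M \<noteq> {} \<and>
    (\<forall>f as. F f = Some (length as) \<longrightarrow> set as \<subseteq> univ M \<longrightarrow> opn M f as \<in> univ M) \<and>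
    (\<forall>a\<in>univ M. \<forall>b\<in>univ M. (lord M a b = 1 \<and> lord M b a = 1) \<longleftrightarrow> a = b) \<and>
    (\<forall>a\<in>univ M. \<forall>b\<in>univ M. \<forall>c\<in>univ M. lord M a b * lord M b c \<le> lord M a c) \<and>
    (\<forall>f as bs. F f = Some (length as) \<longrightarrow> length bs = length as \<longrightarrow>
       set as \<subseteq> univ M \<longrightarrow> set bs \<subseteq> univ M \<longrightarrow>
       prod_list (map2 (lord M) as bs) \<le> lord M (opn M f as) (opn M f bs))"

primrec trm_value :: "('f, 'm, 'l) lalgebra \<Rightarrow> ('x \<Rightarrow> 'm) \<Rightarrow> ('f, 'x) trm \<Rightarrow> 'm"
  where
    "trm_value M v (Var x) = v x"
  | "trm_value M v (Fun f ts) = opn M f (map (trm_value M v) ts)"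

text \<open>Valuations are arbitrary outside \<open>X\<close>; this does not affect the values of terms over \<open>X\<close>.\<close>

definition truth_degree ::
  "'x set \<Rightarrow> ('f, 'm, 'l::complete_residuated_lattice) lalgebra \<Rightarrow> ('f, 'x) ineq \<Rightarrow> 'l"
  where "truth_degree X M \<phi> =
    (INF v \<in> X \<rightarrow> univ M. lord M (trm_value M v (fst \<phi>)) (trm_value M v (snd \<phi>)))"

definition is_model ::
  "('f \<rightharpoonup> nat) \<Rightarrow> 'x set \<Rightarrow> (('f, 'x) ineq \<Rightarrow> 'l::complete_residuated_lattice) \<Rightarrow>
    ('f, 'm, 'l) lalgebra \<Rightarrow> bool"
  where "is_model F X \<Sigma> M \<longleftrightarrow>
    algebra_with_lorder F M \<and> (\<forall>\<phi>\<in>terms F X \<times> terms F X. \<Sigma> \<phi> \<le> truth_degree X M \<phi>)"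

text \<open>The models of \<open>\<Sigma>\<close> form a proper class, so the meet is taken over the models whose universe is
  a subset of the type passed as the first argument.  The meet over all models whatsoever is
  characterised by being a lower bound of \<open>semantic_degree TYPE('m)\<close> for every type \<open>'m\<close> and
  being equal to it for one \<open>'m\<close>; a suitable \<open>'m\<close> is the type of sets of terms, which hosts
  the quotients of the term algebra.\<close>

definition semantic_degree ::
  "'m itself \<Rightarrow> ('f \<rightharpoonup> nat) \<Rightarrow> 'x set \<Rightarrow> (('f, 'x) ineq \<Rightarrow> 'l::complete_residuated_lattice) \<Rightarrow>
    ('f, 'x) ineq \<Rightarrow> 'l"
  where "semantic_degree _ F X \<Sigma> \<phi> =
    (INF M \<in> {M :: ('f, 'm, 'l) lalgebra. is_model F X \<Sigma> M}. truth_degree X M \<phi>)"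

definition logical_axioms :: "('f, 'x) ineq \<Rightarrow> 'l::complete_residuated_lattice"
  where "logical_axioms \<phi> = (if fst \<phi> = snd \<phi> then 1 else bot)"

definition term_endomorphism ::
  "('f \<rightharpoonup> nat) \<Rightarrow> 'x set \<Rightarrow> (('f, 'x) trm \<Rightarrow> ('f, 'x) trm) \<Rightarrow> bool"
  where "term_endomorphism F X h \<longleftrightarrow>
    h \<in> terms F X \<rightarrow> terms F X \<and>
    (\<forall>f ts. Fun f ts \<in> terms F X \<longrightarrow> h (Fun f ts) = Fun f (map h ts))"

text \<open>\<open>inferable F X S p\<close>: the weighted inequality \<open>p\<close> results from members of \<open>S\<close> by a single
  application of a deduction rule.  In \<open>compatibility\<close> the list \<open>ps\<close> is the sequence of premises
  \<open>((t\<^sub>i, t\<^sub>i'), a\<^sub>i)\<close>.\<close>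

inductive inferable ::
  "('f \<rightharpoonup> nat) \<Rightarrow> 'x set \<Rightarrow> (('f, 'x) ineq \<times> 'l::complete_residuated_lattice) set \<Rightarrow>
    ('f, 'x) ineq \<times> 'l \<Rightarrow> bool"
  for F :: "'f \<rightharpoonup> nat" and X :: "'x set"
    and S :: "(('f, 'x) ineq \<times> 'l::complete_residuated_lattice) set"
  where
    transitivity:
      "((t, t'), a) \<in> S \<Longrightarrow> ((t', t''), b) \<in> S \<Longrightarrow> inferable F X S ((t, t''), a * b)"
  | compatibility:
      "F f = Some (length ps) \<Longrightarrow> set ps \<subseteq> S \<Longrightarrow>
       inferable F X S
         ((Fun f (map (\<lambda>((t, t'), a). t) ps), Fun f (map (\<lambda>((t, t'), a). t') ps)),
          prod_list (map (\<lambda>((t, t'), a). a) ps))"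
  | invariance:
      "term_endomorphism F X h \<Longrightarrow> ((t, t'), a) \<in> S \<Longrightarrow> inferable F X S ((h t, h t'), a)"

definition is_proof ::
  "('f \<rightharpoonup> nat) \<Rightarrow> 'x set \<Rightarrow> (('f, 'x) ineq \<Rightarrow> 'l::complete_residuated_lattice) \<Rightarrow>
    (('f, 'x) ineq \<times> 'l) list \<Rightarrow> bool"
  where "is_proof F X \<Sigma> ps \<longleftrightarrow>
    ps \<noteq> [] \<and>
    (\<forall>i<length ps. case ps ! i of (\<phi>, a) \<Rightarrow>
       \<phi> \<in> terms F X \<times> terms F X \<and>
       (a = \<Sigma> \<phi> \<or> a = logical_axioms \<phi> \<or> inferable F X (set (take i ps)) (\<phi>, a)))"

definition provability_degree ::
  "('f \<rightharpoonup> nat) \<Rightarrow> 'x set \<Rightarrow> (('f, 'x) ineq \<Rightarrow> 'l::complete_residuated_lattice) \<Rightarrow>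
    ('f, 'x) ineq \<Rightarrow> 'l"
  where "provability_degree F X \<Sigma> \<phi> = Sup {a. \<exists>ps. is_proof F X \<Sigma> ps \<and> last ps = (\<phi>, a)}"

end

theory Submission imports Defs
begin

text \<open>Soundness is an induction on the length of proofs; for the invariance rule, the value of
  \<open>h t\<close> under \<open>v\<close> is the value of \<open>t\<close> under the valuation \<open>x \<mapsto> \<parallel>h x\<parallel>\<^sub>v\<close>.  For
  completeness, adjointness makes the product distribute over suprema, so the degrees of
  provability are themselves closed under the deduction rules.  They form a compatible preorder
  with degrees in the lattice on the term algebra; dividing by the kernel of its \<open>1\<close>-cut gives a
  model.  A valuation into this model is a substitution followed by the projection, so invariance
  shows that it is a model, and the valuation by variables attains the provability degree.\<close>

section \<open>Complete residuated lattices\<close>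

context complete_residuated_lattice
begin

text \<open>The inequality \<open>y \<le> residuum z (y * z)\<close> is the unit of the adjunction;
  it gives monotonicity in the left factor, and commutativity gives the right one.\<close>

lemma mult_mono:
  assumes "a \<le> b" and "c \<le> d"
  shows "a * c \<le> b * d"
proof -
  have mult_right_mono: "x * z \<le> y * z" if "x \<le> y" for x y z
  proof -
    have "y \<le> residuum z (y * z)"
      by (simp add: adjointness[symmetric])
    with that have "x \<le> residuum z (y * z)"
      by (rule order_trans)
    then show ?thesis
      by (simp add: adjointness)
  qed
  have "a * c \<le> b * c"
    using assms(1) by (rule mult_right_mono)
  also have "b * c \<le> b * d"
    using mult_right_mono[OF assms(2), of b] by (simp add: mult.commute)
  finally show ?thesis .
qed

lemma le_one: "a \<le> 1"
  by (simp add: one_eq_top)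

text \<open>Multiplication by \<open>b\<close> is a left adjoint and hence preserves suprema;
  phrased through upper bounds, this follows from adjointness and the universal property of
  \<open>Sup\<close>.\<close>

lemma Sup_mult_le_iff: "Sup A * b \<le> c \<longleftrightarrow> (\<forall>a\<in>A. a * b \<le> c)"
  by (simp add: adjointness Sup_le_iff)

lemma mult_Sup_le_iff: "b * Sup A \<le> c \<longleftrightarrow> (\<forall>a\<in>A. b * a \<le> c)"
  using Sup_mult_le_iff[of A b c] by (simp add: mult.commute)

lemma prod_list_mono:
  "list_all2 (\<le>) as bs \<Longrightarrow> prod_list as \<le> prod_list bs"
  by (induction rule: list_all2_induct) (auto intro: mult_mono)

text \<open>Adjointness moves the head factor \<open>a\<close> into the bound, so the induction
  hypothesis is applied with \<open>residuum a c\<close>; this is why \<open>c\<close> varies in the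
  induction.\<close>

lemma prod_list_Sup_le:
  assumes "\<And>as. list_all2 (\<in>) as As \<Longrightarrow> prod_list as \<le> c"
  shows "prod_list (map Sup As) \<le> c"
  using assms
proof (induction As arbitrary: c)
  case Nil
  then show ?case by simp
next
  case (Cons A As)
  have "a * prod_list (map Sup As) \<le> c" if "a \<in> A" for a
  proof -
    have "prod_list as \<le> residuum a c" if "list_all2 (\<in>) as As" for as
      using Cons.prems[of "a # as"] that \<open>a \<in> A\<close>
      by (simp add: adjointness[symmetric] mult.commute)
    then have "prod_list (map Sup As) \<le> residuum a c"
      by (rule Cons.IH)
    then show ?thesis
      by (simp add: adjointness[symmetric] mult.commute)
  qed
  then show ?case
    by (simp add: Sup_mult_le_iff)
qed

end

section \<open>Terms and substitutions\<close>

lemma Fun_in_terms_iff: "Fun f ts \<in> terms F X \<longleftrightarrow> F f = Some (length ts) \<and> set ts \<subseteq> terms F X"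
  by (auto intro: terms.Fun elim: terms.cases)

lemma trm_value_in_univ:
  assumes "t \<in> terms F X" and "algebra_with_lorder F M" and "v \<in> X \<rightarrow> univ M"
  shows "trm_value M v t \<in> univ M"
  using assms(1)
proof induction
  case (Var x)
  then show ?case using assms(3) by auto
next
  case (Fun f ts)
  then have "set (map (trm_value M v) ts) \<subseteq> univ M"
    by auto
  moreover have "F f = Some (length (map (trm_value M v) ts))"
    using Fun by simp
  ultimately show ?case
    using assms(2) unfolding algebra_with_lorder_def trm_value.simps by blast
qed

text \<open>Both sides commute with the function symbols and agree on variables, so they agree on
  all terms over \<open>X\<close>.\<close>

lemma trm_value_endomorphism:
  assumes "t \<in> terms F X" and "term_endomorphism F X h"
  shows "trm_value M v (h t) = trm_value M (\<lambda>x. trm_value M v (h (Var x))) t"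
  using assms(1)
proof induction
  case (Var x)
  then show ?case by simp
next
  case (Fun f ts)
  then have "Fun f ts \<in> terms F X"
    by (auto intro: terms.Fun)
  then have "h (Fun f ts) = Fun f (map h ts)"
    using assms(2) by (simp add: term_endomorphism_def)
  then show ?case
    using Fun by (simp add: comp_def cong: map_cong)
qed

text \<open>The invariance rule speaks of endomorphisms only; this supplies the endomorphism
  determined by given images of the variables.\<close>

primrec subst :: "('x \<Rightarrow> ('f, 'x) trm) \<Rightarrow> ('f, 'x) trm \<Rightarrow> ('f, 'x) trm"
  where
    "subst \<theta> (Var x) = \<theta> x"
  | "subst \<theta> (Fun f ts) = Fun f (map (subst \<theta>) ts)"

lemma subst_Var: "subst Var t = t"
  by (induction t) (simp_all add: map_idI)

lemma subst_in_terms: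
  assumes "t \<in> terms F X" and "\<theta> \<in> X \<rightarrow> terms F X"
  shows "subst \<theta> t \<in> terms F X"
  using assms(1) by induction (use assms(2) in \<open>auto simp: Fun_in_terms_iff\<close>)

lemma term_endomorphism_subst:
  "\<theta> \<in> X \<rightarrow> terms F X \<Longrightarrow> term_endomorphism F X (subst \<theta>)"
  by (simp add: term_endomorphism_def subst_in_terms)

section \<open>Provable weighted inequalities\<close>

definition provable ::
  "('f \<rightharpoonup> nat) \<Rightarrow> 'x set \<Rightarrow> (('f, 'x) ineq \<Rightarrow> 'l::complete_residuated_lattice) \<Rightarrow>
    (('f, 'x) ineq \<times> 'l) set"
  where "provable F X \<Sigma> = {p. \<exists>ps. is_proof F X \<Sigma> ps \<and> last ps = p}"

lemma provability_degree_eq: "provability_degree F X \<Sigma> \<phi> = Sup {a. (\<phi>, a) \<in> provable F X \<Sigma>}"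
  by (simp add: provability_degree_def provable_def)

lemma provable_le_provability_degree:
  "(\<phi>, a) \<in> provable F X \<Sigma> \<Longrightarrow> a \<le> provability_degree F X \<Sigma> \<phi>"
  by (simp add: provability_degree_eq Sup_upper)

section \<open>Combining proofs\<close>

lemma inferable_mono:
  assumes "inferable F X S p" and "S \<subseteq> S'"
  shows "inferable F X S' p"
  using assms by cases (auto intro: inferable.intros)

lemma is_proofD:
  assumes "is_proof F X \<Sigma> ps" and "i < length ps" and "ps ! i = (\<phi>, a)"
  shows "\<phi> \<in> terms F X \<times> terms F X \<and>
    (a = \<Sigma> \<phi> \<or> a = logical_axioms \<phi> \<or> inferable F X (set (take i ps)) (\<phi>, a))"
proof -
  have "case ps ! i of (\<phi>, a) \<Rightarrow> \<phi> \<in> terms F X \<times> terms F X \<and>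
    (a = \<Sigma> \<phi> \<or> a = logical_axioms \<phi> \<or> inferable F X (set (take i ps)) (\<phi>, a))"
    using assms(1,2) by (simp add: is_proof_def)
  then show ?thesis
    by (simp add: assms(3))
qed

lemma provable_in_terms:
  assumes "(\<phi>, a) \<in> provable F X \<Sigma>"
  shows "\<phi> \<in> terms F X \<times> terms F X"
proof -
  obtain ps where ps: "is_proof F X \<Sigma> ps" "last ps = (\<phi>, a)"
    using assms by (auto simp: provable_def)
  then have "ps ! (length ps - 1) = (\<phi>, a)" and "length ps - 1 < length ps"
    by (auto simp: is_proof_def last_conv_nth)
  then show ?thesis
    using is_proofD[OF ps(1)] by blast
qed

text \<open>Proofs are nonempty by definition, whereas there may be no premises to collect; hence the
  case \<open>ps = []\<close> here and below.\<close>

lemma is_proof_append: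
  assumes "ps = [] \<or> is_proof F X \<Sigma> ps" and "is_proof F X \<Sigma> qs"
  shows "is_proof F X \<Sigma> (ps @ qs)"
  unfolding is_proof_def
proof (intro conjI allI impI)
  show "ps @ qs \<noteq> []"
    using assms(2) by (simp add: is_proof_def)
next
  fix i
  assume i: "i < length (ps @ qs)"
  show "case (ps @ qs) ! i of (\<phi>, a) \<Rightarrow> \<phi> \<in> terms F X \<times> terms F X \<and>
    (a = \<Sigma> \<phi> \<or> a = logical_axioms \<phi> \<or> inferable F X (set (take i (ps @ qs))) (\<phi>, a))"
  proof (cases "i < length ps")
    case True
    then have "is_proof F X \<Sigma> ps"
      using assms(1) by auto
    then show ?thesis
      using True by (auto simp: is_proof_def nth_append)
  next
    case False
    \<comment> \<open>Members of \<open>qs\<close> keep their justification: position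
      \<open>i\<close> of the concatenation is position \<open>j\<close> of \<open>qs\<close>, and
      what precedes it in \<open>qs\<close> also precedes it in \<open>ps @ qs\<close>.\<close>
    define j where "j = i - length ps"
    have "j < length qs"
      using False i by (auto simp: j_def)
    then have "case qs ! j of (\<phi>, a) \<Rightarrow> \<phi> \<in> terms F X \<times> terms F X \<and>
      (a = \<Sigma> \<phi> \<or> a = logical_axioms \<phi> \<or> inferable F X (set (take j qs)) (\<phi>, a))"
      using assms(2) by (auto simp: is_proof_def)
    moreover have "(ps @ qs) ! i = qs ! j"
      using False by (simp add: nth_append j_def)
    moreover have "set (take j qs) \<subseteq> set (take i (ps @ qs))"
      using False by (simp add: j_def)
    ultimately show ?thesis
      by (auto split: prod.splits dest: inferable_mono)
  qed
qed

lemma is_proof_snoc: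
  assumes "ps = [] \<or> is_proof F X \<Sigma> ps" and "\<phi> \<in> terms F X \<times> terms F X"
    and "a = \<Sigma> \<phi> \<or> a = logical_axioms \<phi> \<or> inferable F X (set ps) (\<phi>, a)"
  shows "is_proof F X \<Sigma> (ps @ [(\<phi>, a)])"
  using assms by (auto simp: is_proof_def nth_append less_Suc_eq)

text \<open>Each member of \<open>qs\<close> is the last entry of a proof of its own, and
  concatenating these proofs yields one that contains them all. This is needed for the compatibility
  rule, whose number of premises is arbitrary.\<close>

lemma provable_collect:
  assumes "set qs \<subseteq> provable F X \<Sigma>"
  shows "\<exists>ps. (ps = [] \<or> is_proof F X \<Sigma> ps) \<and> set qs \<subseteq> set ps"
  using assms
proof (induction qs)
  case Nil
  then show ?case by auto
next
  case (Cons q qs)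
  then obtain ps where ps: "ps = [] \<or> is_proof F X \<Sigma> ps" "set qs \<subseteq> set ps"
    by auto
  obtain rs where rs: "is_proof F X \<Sigma> rs" "last rs = q"
    using Cons.prems by (auto simp: provable_def)
  then have "q \<in> set rs"
    using last_in_set[of rs] by (auto simp: is_proof_def)
  then show ?case
    using is_proof_append[OF ps(1) rs(1)] ps(2) by (intro exI[of _ "ps @ rs"]) auto
qed

text \<open>The inference is appended to a common proof of its premises. The premises form a list
  because only finitely many of them fit into one proof.\<close>

lemma provable_inferable:
  assumes "inferable F X (set qs) (\<phi>, a)" and "set qs \<subseteq> provable F X \<Sigma>"
    and "\<phi> \<in> terms F X \<times> terms F X"
  shows "(\<phi>, a) \<in> provable F X \<Sigma>"
proof -
  obtain ps where ps: "ps = [] \<or> is_proof F X \<Sigma> ps" "set qs \<subseteq> set ps"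
    using provable_collect[OF assms(2)] by blast
  then have "is_proof F X \<Sigma> (ps @ [(\<phi>, a)])"
    using assms inferable_mono by (blast intro: is_proof_snoc)
  then show ?thesis
    by (auto simp: provable_def)
qed

section \<open>Axioms and deduction rules as closure properties\<close>

lemma provable_hypothesis:
  "\<phi> \<in> terms F X \<times> terms F X \<Longrightarrow> (\<phi>, \<Sigma> \<phi>) \<in> provable F X \<Sigma>"
  using is_proof_snoc[of "[]" F X \<Sigma> \<phi> "\<Sigma> \<phi>"] by (auto simp: provable_def)

lemma provable_refl: "t \<in> terms F X \<Longrightarrow> ((t, t), 1) \<in> provable F X \<Sigma>"
  using is_proof_snoc[of "[]" F X \<Sigma> "(t, t)" 1] by (auto simp: provable_def logical_axioms_def)

lemma provable_trans:
  assumes "((t, t'), a) \<in> provable F X \<Sigma>" and "((t', t''), b) \<in> provable F X \<Sigma>"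
  shows "((t, t''), a * b) \<in> provable F X \<Sigma>"
proof (rule provable_inferable)
  show "inferable F X (set [((t, t'), a), ((t', t''), b)]) ((t, t''), a * b)"
    by (rule inferable.transitivity) auto
  show "(t, t'') \<in> terms F X \<times> terms F X"
    using assms[THEN provable_in_terms] by auto
qed (use assms in auto)

lemma provable_invariance:
  assumes "((t, t'), a) \<in> provable F X \<Sigma>" and "term_endomorphism F X h"
  shows "((h t, h t'), a) \<in> provable F X \<Sigma>"
proof (rule provable_inferable)
  show "inferable F X (set [((t, t'), a)]) ((h t, h t'), a)"
    using assms(2) by (rule inferable.invariance) auto
  show "(h t, h t') \<in> terms F X \<times> terms F X"
    using assms(1)[THEN provable_in_terms] assms(2) by (auto simp: term_endomorphism_def)
qed (use assms in auto)

lemma provable_compatible: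
  assumes "F f = Some (length ps)" and "set ps \<subseteq> provable F X \<Sigma>"
  shows "((Fun f (map (\<lambda>((t, t'), a). t) ps), Fun f (map (\<lambda>((t, t'), a). t') ps)),
    prod_list (map (\<lambda>((t, t'), a). a) ps)) \<in> provable F X \<Sigma>"
proof (rule provable_inferable[OF inferable.compatibility])
  have "fst (fst p) \<in> terms F X \<and> snd (fst p) \<in> terms F X" if "p \<in> set ps" for p
    using that assms(2) provable_in_terms[of "fst p" "snd p"] by (auto simp: mem_Times_iff)
  then show "(Fun f (map (\<lambda>((t, t'), a). t) ps), Fun f (map (\<lambda>((t, t'), a). t') ps))
      \<in> terms F X \<times> terms F X"
    using assms(1) by (fastforce simp: Fun_in_terms_iff)
qed (use assms in auto)

section \<open>Soundness\<close>

lemma lord_le_of_le_truth_degree: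
  assumes "a \<le> truth_degree X M (t, t')" and "v \<in> X \<rightarrow> univ M"
  shows "a \<le> lord M (trm_value M v t) (trm_value M v t')"
proof -
  have "truth_degree X M (t, t') \<le> lord M (trm_value M v t) (trm_value M v t')"
    unfolding truth_degree_def using assms(2) by (intro INF_lower2[of v]) auto
  then show ?thesis
    using assms(1) by (rule order_trans[rotated])
qed

lemma le_truth_degreeI:
  assumes "\<And>v. v \<in> X \<rightarrow> univ M \<Longrightarrow> a \<le> lord M (trm_value M v t) (trm_value M v t')"
  shows "a \<le> truth_degree X M (t, t')"
  using assms by (auto simp: truth_degree_def intro: INF_greatest)

lemma lord_refl:
  assumes "algebra_with_lorder F M" and "a \<in> univ M"
  shows "lord M a a = 1"
proof -
  have antisym: "\<forall>a\<in>univ M. \<forall>b\<in>univ M. (lord M a b = 1 \<and> lord M b a = 1) \<longleftrightarrow> a = b"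
    using assms(1) unfolding algebra_with_lorder_def by (elim conjE)
  show ?thesis
    using bspec[OF bspec[OF antisym assms(2)] assms(2)] by simp
qed

text \<open>Transitivity and compatibility rest on the corresponding conditions on the order of
  \<open>M\<close>, which are available only inside \<open>univ M\<close>. Therefore
  \<open>sound\<close> also records that the formulas consist of terms over \<open>X\<close>, whose
  values lie there.\<close>

lemma inferable_sound:
  assumes M: "algebra_with_lorder F M"
    and sound: "\<And>\<phi> a. (\<phi>, a) \<in> S \<Longrightarrow> \<phi> \<in> terms F X \<times> terms F X \<and> a \<le> truth_degree X M \<phi>"
    and "inferable F X S p"
  shows "snd p \<le> truth_degree X M (fst p)"
  using assms(3)
proof cases
  case (transitivity t t' a t'' b)
  have "a * b \<le> truth_degree X M (t, t'')"
  proof (rule le_truth_degreeI)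
    fix v assume v: "v \<in> X \<rightarrow> univ M"
    let ?V = "trm_value M v"
    have "a * b \<le> lord M (?V t) (?V t') * lord M (?V t') (?V t'')"
      using sound[OF transitivity(2)] sound[OF transitivity(3)] v
      by (intro mult_mono lord_le_of_le_truth_degree) auto
    also have "?V t \<in> univ M \<and> ?V t' \<in> univ M \<and> ?V t'' \<in> univ M"
      using sound[OF transitivity(2)] sound[OF transitivity(3)] M v trm_value_in_univ by blast
    then have "lord M (?V t) (?V t') * lord M (?V t') (?V t'') \<le> lord M (?V t) (?V t'')"
      using M unfolding algebra_with_lorder_def by blast
    finally show "a * b \<le> lord M (?V t) (?V t'')" .
  qed
  then show ?thesis
    using transitivity by simp
next
  case (compatibility f ps)
  let ?ts = "map (\<lambda>((t, t'), a). t) ps" and ?us = "map (\<lambda>((t, t'), a). t') ps"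
    and ?as = "map (\<lambda>((t, t'), a). a) ps"
  have "prod_list ?as \<le> truth_degree X M (Fun f ?ts, Fun f ?us)"
  proof (rule le_truth_degreeI)
    fix v assume v: "v \<in> X \<rightarrow> univ M"
    let ?V = "trm_value M v"
    have ps: "t \<in> terms F X \<and> u \<in> terms F X \<and> a \<le> lord M (?V t) (?V u)"
      if "((t, u), a) \<in> set ps" for t u a
      using sound[of "(t, u)" a] that compatibility(3) lord_le_of_le_truth_degree[OF _ v] by auto
    have "prod_list ?as \<le> prod_list (map2 (lord M) (map ?V ?ts) (map ?V ?us))"
    proof (rule prod_list_mono, rule list_all2_all_nthI)
      fix i
      assume "i < length ?as"
      moreover obtain t u a where "ps ! i = ((t, u), a)"
        by (metis prod.exhaust)
      ultimately show "?as ! i \<le> map2 (lord M) (map ?V ?ts) (map ?V ?us) ! i"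
        using ps[of t u a] nth_mem[of i ps] by simp
    qed simp
    also have "F f = Some (length (map ?V ?ts))" "length (map ?V ?us) = length (map ?V ?ts)"
      "set (map ?V ?ts) \<subseteq> univ M" "set (map ?V ?us) \<subseteq> univ M"
      using compatibility(2) ps trm_value_in_univ[OF _ M v] by auto
    then have "prod_list (map2 (lord M) (map ?V ?ts) (map ?V ?us))
        \<le> lord M (opn M f (map ?V ?ts)) (opn M f (map ?V ?us))"
      using M unfolding algebra_with_lorder_def by blast
    finally show "prod_list ?as \<le> lord M (?V (Fun f ?ts)) (?V (Fun f ?us))"
      by simp
  qed
  then show ?thesis
    using compatibility(1) by simp
next
  case (invariance h t t' a)
  have "a \<le> truth_degree X M (h t, h t')"
  proof (rule le_truth_degreeI)
    fix v assume v: "v \<in> X \<rightarrow> univ M"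
    \<comment> \<open>The pulled-back valuation again maps \<open>X\<close> into
      \<open>univ M\<close>, so the truth degree of the premise bounds the instance at it.\<close>
    have "(\<lambda>x. trm_value M v (h (Var x))) \<in> X \<rightarrow> univ M"
      using invariance(2) trm_value_in_univ[OF _ M v]
      by (auto simp: term_endomorphism_def intro: terms.Var)
    then show "a \<le> lord M (trm_value M v (h t)) (trm_value M v (h t'))"
      using sound[OF invariance(3)] lord_le_of_le_truth_degree[of a X M t t']
        trm_value_endomorphism[OF _ invariance(2), of t M v]
        trm_value_endomorphism[OF _ invariance(2), of t' M v]
      by simp
  qed
  then show ?thesis
    using invariance by simp
qed

lemma is_model_le_truth_degree:
  assumes "is_model F X \<Sigma> M" and "\<phi> \<in> terms F X \<times> terms F X"
  shows "\<Sigma> \<phi> \<le> truth_degree X M \<phi>"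
  using assms unfolding is_model_def by blast

text \<open>A step may use any earlier members of the proof, so the claim is made for every position
  and proved by strong induction.\<close>

lemma is_proof_sound:
  assumes M: "is_model F X \<Sigma> M" and ps: "is_proof F X \<Sigma> ps" and "i < length ps"
  shows "snd (ps ! i) \<le> truth_degree X M (fst (ps ! i))"
  using assms(3)
proof (induction i rule: less_induct)
  case (less i)
  obtain \<phi> a where eq: "ps ! i = (\<phi>, a)"
    by (rule prod.exhaust)
  have alg: "algebra_with_lorder F M"
    using M by (simp add: is_model_def)
  have step: "\<phi> \<in> terms F X \<times> terms F X"
    "a = \<Sigma> \<phi> \<or> a = logical_axioms \<phi> \<or> inferable F X (set (take i ps)) (\<phi>, a)"
    using is_proofD[OF ps less.prems eq] by simp_all
  have "a \<le> truth_degree X M \<phi>"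
    using step(2)
  proof (elim disjE)
    assume "a = \<Sigma> \<phi>"
    then show ?thesis
      using is_model_le_truth_degree[OF M step(1)] by simp
  next
    assume a: "a = logical_axioms \<phi>"
    show ?thesis
    proof (cases "fst \<phi> = snd \<phi>")
      case True
      then obtain t where t: "\<phi> = (t, t)" "t \<in> terms F X"
        using step(1) by (cases \<phi>) auto
      have "1 \<le> truth_degree X M (t, t)"
      proof (rule le_truth_degreeI)
        fix v assume "v \<in> X \<rightarrow> univ M"
        then have "trm_value M v t \<in> univ M"
          by (rule trm_value_in_univ[OF t(2) alg])
        then show "1 \<le> lord M (trm_value M v t) (trm_value M v t)"
          by (simp add: lord_refl[OF alg])
      qed
      then show ?thesis
        using a t by (simp add: logical_axioms_def)
    next
      case False
      then have "a = bot"
        using a by (simp add: logical_axioms_def)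
      then show ?thesis
        by simp
    qed
  next
    assume inf: "inferable F X (set (take i ps)) (\<phi>, a)"
    have "\<psi> \<in> terms F X \<times> terms F X \<and> b \<le> truth_degree X M \<psi>"
      if mem: "(\<psi>, b) \<in> set (take i ps)" for \<psi> b
    proof -
      obtain j where j: "j < i" "j < length ps" "ps ! j = (\<psi>, b)"
        using mem by (auto simp: in_set_conv_nth)
      then show ?thesis
        using less.IH[OF j(1,2)] is_proofD[OF ps j(2,3)] by simp
    qed
    then have "snd (\<phi>, a) \<le> truth_degree X M (fst (\<phi>, a))"
      using inf by (rule inferable_sound[OF alg])
    then show ?thesis
      by simp
  qed
  then show ?case
    using eq by simp
qed

lemma provability_degree_le_truth_degree:
  assumes "is_model F X \<Sigma> M"
  shows "provability_degree F X \<Sigma> \<phi> \<le> truth_degree X M \<phi>"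
  unfolding provability_degree_def
proof (rule Sup_least, clarify)
  fix a ps
  assume ps: "is_proof F X \<Sigma> ps" "last ps = (\<phi>, a)"
  then have "ps \<noteq> []"
    by (simp add: is_proof_def)
  then have "ps ! (length ps - 1) = (\<phi>, a)" and "length ps - 1 < length ps"
    using ps(2) by (simp_all add: last_conv_nth)
  then show "a \<le> truth_degree X M \<phi>"
    using is_proof_sound[OF assms ps(1)] by (metis fst_conv snd_conv)
qed

section \<open>Closure properties of provability degrees\<close>

lemma provability_degree_refl:
  "t \<in> terms F X \<Longrightarrow> provability_degree F X \<Sigma> (t, t) = 1"
  by (intro antisym le_one provable_le_provability_degree provable_refl)

lemma hypothesis_le_provability_degree:
  "\<phi> \<in> terms F X \<times> terms F X \<Longrightarrow> \<Sigma> \<phi> \<le> provability_degree F X \<Sigma> \<phi>"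
  by (intro provable_le_provability_degree provable_hypothesis)

lemma provability_degree_trans:
  "provability_degree F X \<Sigma> (t, t') * provability_degree F X \<Sigma> (t', t'')
    \<le> provability_degree F X \<Sigma> (t, t'')"
  \<comment> \<open>Only the two factors on the left become suprema. Distributivity then leaves a
    product of two provable degrees, which is itself provable by the transitivity rule.\<close>
  unfolding provability_degree_eq[of F X \<Sigma> "(t, t')"] provability_degree_eq[of F X \<Sigma> "(t', t'')"]
  by (auto simp: Sup_mult_le_iff mult_Sup_le_iff
      intro: provable_le_provability_degree provable_trans)

lemma provability_degree_invariance:
  "term_endomorphism F X h \<Longrightarrow>
    provability_degree F X \<Sigma> (t, t') \<le> provability_degree F X \<Sigma> (h t, h t')"
  unfolding provability_degree_eq
  by (rule Sup_subset_mono) (blast intro: provable_invariance)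

lemma provability_degree_compatible:
  assumes "F f = Some (length ts)" and len: "length us = length ts"
  shows "prod_list (map2 (\<lambda>t u. provability_degree F X \<Sigma> (t, u)) ts us)
    \<le> provability_degree F X \<Sigma> (Fun f ts, Fun f us)"
proof -
  \<comment> \<open>For each pair of arguments, \<open>?As\<close> lists the set of its provable
    degrees. A choice \<open>as\<close> of one degree from each set supplies the premises for one
    use of the compatibility rule.\<close>
  let ?As = "map (\<lambda>\<phi>. {a. (\<phi>, a) \<in> provable F X \<Sigma>}) (zip ts us)"
  have "prod_list as \<le> provability_degree F X \<Sigma> (Fun f ts, Fun f us)"
    if as: "list_all2 (\<in>) as ?As" for as
  proof -
    define ps where "ps = zip (zip ts us) as"
    have len_as: "length as = length ts"
      using as len by (auto dest: list_all2_lengthD)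
    have "map (\<lambda>((t, t'), a). t) ps = ts" "map (\<lambda>((t, t'), a). t') ps = us"
      "map (\<lambda>((t, t'), a). a) ps = as"
      using len len_as by (auto simp: ps_def intro!: nth_equalityI)
    moreover have "set ps \<subseteq> provable F X \<Sigma>"
      using as len len_as by (auto simp: ps_def list_all2_conv_all_nth in_set_zip)
    moreover have "F f = Some (length ps)"
      using assms len_as by (simp add: ps_def)
    ultimately have "((Fun f ts, Fun f us), prod_list as) \<in> provable F X \<Sigma>"
      using provable_compatible[of F f ps X \<Sigma>] by simp
    then show ?thesis
      by (rule provable_le_provability_degree)
  qed
  then have "prod_list (map Sup ?As) \<le> provability_degree F X \<Sigma> (Fun f ts, Fun f us)"
    by (rule prod_list_Sup_le)
  then show ?thesis
    by (simp add: provability_degree_eq case_prod_unfold comp_def)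
qed

section \<open>The quotient of the term algebra by mutual provability in degree 1\<close>

text \<open>These terms must be identified because the order of a model admits degree
  \<open>1\<close> in both directions only between equal elements.\<close>

definition provability_class ::
  "('f \<rightharpoonup> nat) \<Rightarrow> 'x set \<Rightarrow> (('f, 'x) ineq \<Rightarrow> 'l::complete_residuated_lattice) \<Rightarrow>
    ('f, 'x) trm \<Rightarrow> ('f, 'x) trm set"
  where "provability_class F X \<Sigma> t = {s \<in> terms F X.
    provability_degree F X \<Sigma> (t, s) = 1 \<and> provability_degree F X \<Sigma> (s, t) = 1}"

definition class_rep :: "'a set \<Rightarrow> 'a"
  where "class_rep A = (SOME s. s \<in> A)"

text \<open>Chosen representatives make the order and the operations total functions on sets of
  terms. On classes the choice does not matter, by \<open>lord_quotient_algebra\<close> and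
  \<open>provability_class_Fun_cong\<close>.\<close>

definition quotient_algebra ::
  "('f \<rightharpoonup> nat) \<Rightarrow> 'x set \<Rightarrow> (('f, 'x) ineq \<Rightarrow> 'l::complete_residuated_lattice) \<Rightarrow>
    ('f, ('f, 'x) trm set, 'l) lalgebra"
  where "quotient_algebra F X \<Sigma> =
    \<lparr>univ = provability_class F X \<Sigma> ` terms F X,
     lord = (\<lambda>A B. provability_degree F X \<Sigma> (class_rep A, class_rep B)),
     opn = (\<lambda>f As. provability_class F X \<Sigma> (Fun f (map class_rep As)))\<rparr>"

text \<open>Since \<open>1\<close> is the unit of the product, a factor of degree \<open>1\<close>
  disappears from transitivity.\<close>

lemma provability_degree_one_trans:
  assumes "provability_degree F X \<Sigma> (t, t') = 1"
  shows "provability_degree F X \<Sigma> (t', t'') \<le> provability_degree F X \<Sigma> (t, t'')"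
    and "provability_degree F X \<Sigma> (t'', t) \<le> provability_degree F X \<Sigma> (t'', t')"
  using provability_degree_trans[of F X \<Sigma> t t' t''] provability_degree_trans[of F X \<Sigma> t'' t t']
  by (simp_all add: assms)

text \<open>Mutual degree \<open>1\<close> makes \<open>t\<close> and \<open>s\<close>
  interchangeable on either side of every inequality. Conversely, \<open>s\<close> lies in its own
  class by reflexivity.\<close>

lemma provability_class_eq_iff:
  assumes "t \<in> terms F X" and "s \<in> terms F X"
  shows "provability_class F X \<Sigma> t = provability_class F X \<Sigma> s \<longleftrightarrow>
    provability_degree F X \<Sigma> (t, s) = 1 \<and> provability_degree F X \<Sigma> (s, t) = 1"
proof
  assume "provability_class F X \<Sigma> t = provability_class F X \<Sigma> s"
  then have "s \<in> provability_class F X \<Sigma> t"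
    using assms(2) by (simp add: provability_class_def provability_degree_refl)
  then show "provability_degree F X \<Sigma> (t, s) = 1 \<and> provability_degree F X \<Sigma> (s, t) = 1"
    by (simp add: provability_class_def)
next
  assume *: "provability_degree F X \<Sigma> (t, s) = 1 \<and> provability_degree F X \<Sigma> (s, t) = 1"
  have "provability_degree F X \<Sigma> (t, r) = provability_degree F X \<Sigma> (s, r)"
    "provability_degree F X \<Sigma> (r, t) = provability_degree F X \<Sigma> (r, s)" for r
    using * by (auto intro: antisym provability_degree_one_trans)
  then show "provability_class F X \<Sigma> t = provability_class F X \<Sigma> s"
    by (simp add: provability_class_def)
qed

lemma class_rep_provability_class:
  assumes "t \<in> terms F X"
  shows "class_rep (provability_class F X \<Sigma> t) \<in> provability_class F X \<Sigma> t"
proof -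
  have "t \<in> provability_class F X \<Sigma> t"
    using assms by (simp add: provability_class_def provability_degree_refl)
  then show ?thesis
    unfolding class_rep_def by (rule someI)
qed

lemma class_rep_univ:
  assumes "A \<in> univ (quotient_algebra F X \<Sigma>)"
  shows "class_rep A \<in> terms F X" and "provability_class F X \<Sigma> (class_rep A) = A"
proof -
  obtain t where t: "t \<in> terms F X" "A = provability_class F X \<Sigma> t"
    using assms by (auto simp: quotient_algebra_def)
  then have rep: "class_rep A \<in> provability_class F X \<Sigma> t"
    using class_rep_provability_class by simp
  then show "class_rep A \<in> terms F X"
    by (simp add: provability_class_def)
  moreover have "provability_degree F X \<Sigma> (class_rep A, t) = 1 \<and>
      provability_degree F X \<Sigma> (t, class_rep A) = 1"
    using rep by (simp add: provability_class_def)
  ultimately have "provability_class F X \<Sigma> (class_rep A) = provability_class F X \<Sigma> t"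
    using t(1) by (simp add: provability_class_eq_iff)
  then show "provability_class F X \<Sigma> (class_rep A) = A"
    by (simp add: t(2))
qed

text \<open>A term and the representative of its class are provable from each other in degree
  \<open>1\<close>, so \<open>t\<close> and \<open>s\<close> can be exchanged for their
  representatives one after the other.\<close>

lemma lord_quotient_algebra:
  assumes "t \<in> terms F X" and "s \<in> terms F X"
  shows "lord (quotient_algebra F X \<Sigma>) (provability_class F X \<Sigma> t) (provability_class F X \<Sigma> s) =
    provability_degree F X \<Sigma> (t, s)"
proof -
  let ?P = "\<lambda>t s. provability_degree F X \<Sigma> (t, s)"
  let ?t = "class_rep (provability_class F X \<Sigma> t)" and ?s = "class_rep (provability_class F X \<Sigma> s)"
  have "?P t ?t = 1" "?P ?t t = 1" "?P s ?s = 1" "?P ?s s = 1"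
    using class_rep_provability_class[OF assms(1), of \<Sigma>] class_rep_provability_class[OF assms(2), of \<Sigma>]
    by (simp_all add: provability_class_def)
  then have "?P t s = ?P ?t s" "?P ?t s = ?P ?t ?s"
    by (auto intro: antisym provability_degree_one_trans)
  then show ?thesis
    by (simp add: quotient_algebra_def)
qed

text \<open>Corresponding arguments are related in degree \<open>1\<close> both ways, so
  compatibility bounds the degree of either inequality between the results from below by a product
  of ones.\<close>

lemma provability_class_Fun_cong:
  assumes "Fun f ts \<in> terms F X" and "set us \<subseteq> terms F X"
    and "map (provability_class F X \<Sigma>) ts = map (provability_class F X \<Sigma>) us"
  shows "provability_class F X \<Sigma> (Fun f ts) = provability_class F X \<Sigma> (Fun f us)"
proof -
  let ?P = "\<lambda>t s. provability_degree F X \<Sigma> (t, s)"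
  have F: "F f = Some (length ts)" and ts: "set ts \<subseteq> terms F X"
    using assms(1) by (simp_all add: Fun_in_terms_iff)
  have len: "length us = length ts"
    using map_eq_imp_length_eq[OF assms(3)] by simp
  have "?P (ts ! i) (us ! i) = 1 \<and> ?P (us ! i) (ts ! i) = 1" if i: "i < length ts" for i
  proof -
    have "provability_class F X \<Sigma> (ts ! i) = provability_class F X \<Sigma> (us ! i)"
      using arg_cong[OF assms(3), of "\<lambda>As. As ! i"] i len by simp
    moreover have "ts ! i \<in> terms F X" "us ! i \<in> terms F X"
      using i len subsetD[OF ts] subsetD[OF assms(2)] by simp_all
    ultimately show ?thesis
      by (simp add: provability_class_eq_iff)
  qed
  then have "map2 ?P ts us = replicate (length ts) 1" "map2 ?P us ts = replicate (length ts) 1"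
    using len by (simp_all add: list_eq_iff_nth_eq)
  then have "1 \<le> ?P (Fun f ts) (Fun f us)" "1 \<le> ?P (Fun f us) (Fun f ts)"
    using provability_degree_compatible[of F f ts us X \<Sigma>, OF F len]
      provability_degree_compatible[of F f us ts X \<Sigma>, OF F[folded len] len[symmetric]]
    by simp_all
  then have "?P (Fun f ts) (Fun f us) = 1" "?P (Fun f us) (Fun f ts) = 1"
    by (auto intro: antisym le_one)
  moreover have "Fun f us \<in> terms F X"
    using F len assms(2) by (simp add: Fun_in_terms_iff)
  ultimately show ?thesis
    using assms(1) by (simp add: provability_class_eq_iff)
qed

lemma algebra_quotient_algebra:
  fixes \<Sigma> :: "('f, 'x) ineq \<Rightarrow> 'l::complete_residuated_lattice"
  assumes "terms F X \<noteq> {}"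
  shows "algebra_with_lorder F (quotient_algebra F X \<Sigma>)"
proof -
  let ?M = "quotient_algebra F X \<Sigma>"
  have Fun_rep: "Fun f (map class_rep as) \<in> terms F X"
    if "F f = Some (length as)" "set as \<subseteq> univ ?M" for f as
    using that class_rep_univ(1) by (fastforce simp: Fun_in_terms_iff)
  show ?thesis
    unfolding algebra_with_lorder_def
  proof (intro conjI allI impI ballI)
    show "univ ?M \<noteq> {}"
      using assms by (simp add: quotient_algebra_def)
  next
    fix f as
    assume "F f = Some (length as)" "set as \<subseteq> univ ?M"
    then show "opn ?M f as \<in> univ ?M"
      using Fun_rep by (simp add: quotient_algebra_def)
  next
    fix a b
    assume "a \<in> univ ?M" "b \<in> univ ?M"
    then show "(lord ?M a b = 1 \<and> lord ?M b a = 1) \<longleftrightarrow> a = b"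
      using provability_class_eq_iff[of "class_rep a" F X "class_rep b" \<Sigma>]
        class_rep_univ[of a F X \<Sigma>] class_rep_univ[of b F X \<Sigma>]
      by (simp add: quotient_algebra_def)
  next
    fix a b c
    show "lord ?M a b * lord ?M b c \<le> lord ?M a c"
      by (simp add: quotient_algebra_def provability_degree_trans)
  next
    fix f as bs
    assume *: "F f = Some (length as)" "length bs = length as"
      "set as \<subseteq> univ ?M" "set bs \<subseteq> univ ?M"
    have "map2 (lord ?M) as bs =
      map2 (\<lambda>t u. provability_degree F X \<Sigma> (t, u)) (map class_rep as) (map class_rep bs)"
      using *(2) by (auto intro!: nth_equalityI simp: quotient_algebra_def)
    also have "prod_list \<dots>
      \<le> provability_degree F X \<Sigma> (Fun f (map class_rep as), Fun f (map class_rep bs))"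
      using * by (intro provability_degree_compatible) auto
    \<comment> \<open>The operations return classes whose chosen representatives may differ from
      these terms, hence the appeal to independence of representatives.\<close>
    also have "\<dots> = lord ?M (opn ?M f as) (opn ?M f bs)"
      using lord_quotient_algebra[OF Fun_rep Fun_rep, of f as f bs \<Sigma>] *
      by (simp add: quotient_algebra_def)
    finally show "prod_list (map2 (lord ?M) as bs) \<le> lord ?M (opn ?M f as) (opn ?M f bs)" .
  qed
qed

text \<open>An operation of the quotient acts on the representatives of the argument values; by
  congruence these may be replaced by the substituted arguments, which lie in the same
  classes.\<close>

lemma trm_value_quotient_algebra:
  assumes "t \<in> terms F X" and \<theta>: "\<theta> \<in> X \<rightarrow> terms F X"
    and v: "\<And>x. x \<in> X \<Longrightarrow> v x = provability_class F X \<Sigma> (\<theta> x)"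
  shows "trm_value (quotient_algebra F X \<Sigma>) v t = provability_class F X \<Sigma> (subst \<theta> t)"
  using assms(1)
proof induction
  case (Var x)
  then show ?case using v by simp
next
  case (Fun f ts)
  let ?M = "quotient_algebra F X \<Sigma>"
  have ts: "subst \<theta> u \<in> terms F X" "trm_value ?M v u = provability_class F X \<Sigma> (subst \<theta> u)"
    if "u \<in> set ts" for u
    using Fun that subst_in_terms[OF _ \<theta>] by auto
  then have univ: "trm_value ?M v u \<in> univ ?M" if "u \<in> set ts" for u
    using that by (simp add: quotient_algebra_def)
  have "provability_class F X \<Sigma> (Fun f (map class_rep (map (trm_value ?M v) ts))) =
    provability_class F X \<Sigma> (Fun f (map (subst \<theta>) ts))"
  proof (rule provability_class_Fun_cong)
    show "Fun f (map class_rep (map (trm_value ?M v) ts)) \<in> terms F X"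
      using Fun(1) univ class_rep_univ(1) by (fastforce simp: Fun_in_terms_iff)
    show "set (map (subst \<theta>) ts) \<subseteq> terms F X"
      using ts by auto
    show "map (provability_class F X \<Sigma>) (map class_rep (map (trm_value ?M v) ts)) =
      map (provability_class F X \<Sigma>) (map (subst \<theta>) ts)"
      using ts(2) class_rep_univ(2)[OF univ] by simp
  qed
  then show ?case
    by (simp add: quotient_algebra_def)
qed

lemma truth_degree_quotient_algebra:
  assumes t: "t \<in> terms F X" and t': "t' \<in> terms F X"
  shows "truth_degree X (quotient_algebra F X \<Sigma>) (t, t') = provability_degree F X \<Sigma> (t, t')"
proof (rule antisym)
  let ?M = "quotient_algebra F X \<Sigma>"
  \<comment> \<open>Under this valuation every term over \<open>X\<close> evaluates to its own
    class, as the accompanying substitution is the identity.\<close>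
  let ?v = "\<lambda>x. provability_class F X \<Sigma> (Var x)"
  have v: "?v \<in> X \<rightarrow> univ ?M" and Var: "Var \<in> X \<rightarrow> terms F X"
    by (auto simp: quotient_algebra_def intro: terms.Var)
  have "trm_value ?M ?v s = provability_class F X \<Sigma> s" if "s \<in> terms F X" for s
    using trm_value_quotient_algebra[OF that Var, of ?v \<Sigma>] by (simp add: subst_Var)
  then show "truth_degree X ?M (t, t') \<le> provability_degree F X \<Sigma> (t, t')"
    using lord_le_of_le_truth_degree[OF order_refl v, of t t'] t t'
    by (simp add: lord_quotient_algebra)
next
  let ?M = "quotient_algebra F X \<Sigma>"
  show "provability_degree F X \<Sigma> (t, t') \<le> truth_degree X ?M (t, t')"
  proof (rule le_truth_degreeI)
    fix v assume v: "v \<in> X \<rightarrow> univ ?M"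
    \<comment> \<open>Picking a representative of each \<open>v x\<close> factors \<open>v\<close>
      on \<open>X\<close> through a substitution, so the bound becomes an instance of
      invariance.\<close>
    let ?\<theta> = "\<lambda>x. class_rep (v x)"
    have \<theta>: "?\<theta> \<in> X \<rightarrow> terms F X" and "\<And>x. x \<in> X \<Longrightarrow> v x = provability_class F X \<Sigma> (?\<theta> x)"
      using v class_rep_univ by fastforce+
    then have "lord ?M (trm_value ?M v t) (trm_value ?M v t') =
      provability_degree F X \<Sigma> (subst ?\<theta> t, subst ?\<theta> t')"
      using t t' by (simp add: trm_value_quotient_algebra lord_quotient_algebra subst_in_terms)
    then show "provability_degree F X \<Sigma> (t, t') \<le> lord ?M (trm_value ?M v t) (trm_value ?M v t')"
      using provability_degree_invariance[OF term_endomorphism_subst[OF \<theta>]] by simp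
  qed
qed

lemma is_model_quotient_algebra:
  "terms F X \<noteq> {} \<Longrightarrow> is_model F X \<Sigma> (quotient_algebra F X \<Sigma>)"
  using hypothesis_le_provability_degree[of _ F X \<Sigma>]
  by (auto simp: is_model_def algebra_quotient_algebra truth_degree_quotient_algebra)

section \<open>Completeness\<close>

theorem theorem1:
  fixes F :: "'f \<rightharpoonup> nat" and X :: "'x set"
    and \<Sigma> :: "('f, 'x) ineq \<Rightarrow> 'l::complete_residuated_lattice"
    and t t' :: "('f, 'x) trm"
  assumes "terms F X \<noteq> {}"
    and "t \<in> terms F X" and "t' \<in> terms F X"
  shows "provability_degree F X \<Sigma> (t, t') =
           semantic_degree TYPE(('f, 'x) trm set) F X \<Sigma> (t, t') \<and>
         provability_degree F X \<Sigma> (t, t') \<le> semantic_degree TYPE('m) F X \<Sigma> (t, t')"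
proof (intro conjI antisym)
  \<comment> \<open>Soundness holds for models over any carrier type and thus serves both
    conjuncts.\<close>
  show "provability_degree F X \<Sigma> (t, t') \<le> semantic_degree TYPE(('f, 'x) trm set) F X \<Sigma> (t, t')"
    and "provability_degree F X \<Sigma> (t, t') \<le> semantic_degree TYPE('m) F X \<Sigma> (t, t')"
    by (auto simp: semantic_degree_def intro: INF_greatest provability_degree_le_truth_degree)
  \<comment> \<open>The elements of the quotient are sets of terms, so it is among the models over
    which this meet ranges.\<close>
  have "semantic_degree TYPE(('f, 'x) trm set) F X \<Sigma> (t, t')
      \<le> truth_degree X (quotient_algebra F X \<Sigma>) (t, t')"
    unfolding semantic_degree_def
    using is_model_quotient_algebra[OF assms(1), of \<Sigma>] by (intro INF_lower) simp
  also have "\<dots> = provability_degree F X \<Sigma> (t, t')"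
    using assms(2,3) by (rule truth_degree_quotient_algebra)
  finally show "semantic_degree TYPE(('f, 'x) trm set) F X \<Sigma> (t, t')
      \<le> provability_degree F X \<Sigma> (t, t')" .
qed

end
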